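(* For every $m,n,\delta\in\mathbb{N}$ such that $\delta\mid mn$, the number $c_\delta(m,n)$ of cyclic subgroups of order $\delta$ of the group $\mathbb{Z}_m\times\mathbb{Z}_n$ is $$c_{\delta}(m,n)=\sum_{\substack{i\mid m,\ j\mid n\\ \operatorname{lcm}(i,j)=\delta}}\phi(\gcd(i,j)).$$
   Context: $\mathbb{N}=\{1,2,\ldots\}$. $\mathbb{Z}_m$ denotes the additive group of residue classes modulo $m$. $\phi$ is Euler's totient function. The sum runs over pairs $(i,j)$ of positive integers satisfying the listed conditions; an empty sum is $0$. *)

theory Defs
  imports "HOL-Algebra.Elementary_Groups" "HOL-Number_Theory.Totient"
begin

definition cyclic_subgroups_of_order :: "('a, 'b) monoid_scheme \<Rightarrow> nat \<Rightarrow> 'a set set" where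
  "cyclic_subgroups_of_order G \<delta> =
     {H. subgroup H G \<and> cyclic_group (G\<lparr>carrier := H\<rparr>) \<and> order (G\<lparr>carrier := H\<rparr>) = \<delta>}"

text \<open>
  \<open>integer_mod_group 0\<close> is the infinite group of integers, so this is the intended count only for positive \<open>m\<close> and \<open>n\<close>.
\<close>

definition num_cyclic_subgroups :: "nat \<Rightarrow> nat \<Rightarrow> nat \<Rightarrow> nat" where
  "num_cyclic_subgroups \<delta> m n =
     card (cyclic_subgroups_of_order (integer_mod_group m \<times>\<times> integer_mod_group n) \<delta>)"

end

theory Submission
  imports Defs "HOL-Algebra.Multiplicative_Group"
begin

text \<open>
  Count the elements of order \<open>\<delta>\<close> of \<open>\<int>\<^sub>m \<times> \<int>\<^sub>n\<close> in two ways. Each such element generates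
  exactly one cyclic subgroup of order \<open>\<delta>\<close>, and each of these has \<open>\<phi>(\<delta>)\<close> generators, so there
  are \<open>c\<^sub>\<delta>(m,n) \<phi>(\<delta>)\<close> of them. On the other hand the order of a pair is the lcm of the orders
  of its components, so there are \<open>\<Sum> \<phi>(i) \<phi>(j)\<close> of them, over the pairs of divisors with
  \<open>lcm(i,j) = \<delta>\<close>. Since \<open>\<phi>(i) \<phi>(j) = \<phi>(gcd(i,j)) \<phi>(lcm(i,j))\<close>, cancelling \<open>\<phi>(\<delta>)\<close> gives
  the formula.
\<close>

text \<open>Powers are componentwise, so a power of \<open>(x, y)\<close> is trivial exactly when
  both orders divide the exponent, that is, when their lcm does. Order 0 for elements of infinite
  order fits this too.\<close>

lemma ord_DirProd:
  assumes "group G" "group H" "x \<in> carrier G" "y \<in> carrier H"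
  shows "group.ord (G \<times>\<times> H) (x, y) = lcm (group.ord G x) (group.ord H y)"
proof -
  interpret G: group G by fact
  interpret H: group H by fact
  interpret GH: group "G \<times>\<times> H" using assms by (simp add: DirProd_group)
  have pow: "(x, y) [^]\<^bsub>G \<times>\<times> H\<^esub> k = (x [^]\<^bsub>G\<^esub> k, y [^]\<^bsub>H\<^esub> k)" for k :: nat
    by (induction k) auto
  show ?thesis
    by (subst GH.ord_unique) (use assms in \<open>auto simp: pow G.pow_eq_id H.pow_eq_id\<close>)
qed

text \<open>The power \<open>a [^] k\<close> has order \<open>ord a\<close> divided by
  \<open>gcd k (ord a)\<close>, so the task is to count exponents with a prescribed gcd. A general
  divisor \<open>d\<close> serves two uses: all orders in a cyclic group, and, with
  \<open>d = ord a\<close>, the generators of a cyclic subgroup.\<close>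

lemma (in group) card_ord_eq_in_generate:
  assumes a: "a \<in> carrier G" and pos: "ord a > 0" and d: "d dvd ord a"
  shows "card {x \<in> generate G {a}. ord x = d} = totient d"
proof -
  let ?n = "ord a"
  \<comment> \<open>Exponents run from 1 to \<open>ord a\<close>, not from 0, to match the range in
    \<open>card_gcd_eq_totient\<close>.\<close>
  have inj: "inj_on (\<lambda>k. a [^] k) {0<..?n}"
    using ord_inj'[OF a] by (rule inj_on_subset) auto
  have sub: "(\<lambda>k. a [^] k) ` {0<..?n} \<subseteq> generate G {a}"
    using generate_pow_nat[OF a] pos by auto
  have fin: "finite (generate G {a})"
    using generate_pow_card[OF a] pos by (metis card.infinite less_numeral_extra(3))
  have gen: "generate G {a} = (\<lambda>k. a [^] k) ` {0<..?n}"
    by (rule sym, rule card_subset_eq[OF fin sub])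
       (simp add: card_image[OF inj] generate_pow_card[OF a, symmetric])
  have iff: "ord (a [^] k) = d \<longleftrightarrow> gcd k ?n = ?n div d" if "k \<in> {0<..?n}" for k
  proof -
    have "ord (a [^] k) = ?n div gcd k ?n"
      using that ord_pow_gen[OF a, of k] by (simp add: gcd.commute)
    moreover have "?n div g = d \<longleftrightarrow> g = ?n div d" if "g dvd ?n" for g
    proof -
      from that d obtain h e where "?n = g * h" "?n = d * e"
        by (auto elim!: dvdE)
      with pos show ?thesis
        by (metis mult.commute mult_is_0 nonzero_mult_div_cancel_left nonzero_mult_div_cancel_right not_gr_zero)
    qed
    ultimately show ?thesis by simp
  qed
  have "{x \<in> generate G {a}. ord x = d} = (\<lambda>k. a [^] k) ` {k \<in> {0<..?n}. gcd k ?n = ?n div d}"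
    unfolding gen using iff by (auto simp: image_iff) blast
  then have "card {x \<in> generate G {a}. ord x = d} = card {k \<in> {0<..?n}. gcd k ?n = ?n div d}"
    by (simp only:) (rule card_image, rule inj_on_subset[OF inj], blast)
  also have "\<dots> = totient (?n div (?n div d))"
    using pos d by (intro card_gcd_eq_totient) auto
  also have "?n div (?n div d) = d"
    using pos d by auto
  finally show ?thesis .
qed

lemma card_ord_eq_integer_mod_group:
  assumes "n > 0" "d dvd n"
  shows "card {x \<in> carrier (integer_mod_group n). group.ord (integer_mod_group n) x = d} = totient d"
proof -
  interpret group "integer_mod_group n" by simp
  \<comment> \<open>The generator is 1, reduced modulo \<open>n\<close> because for
    \<open>n = 1\<close> the only element of the carrier is 0.\<close>
  define a :: int where "a = 1 mod int n"
  have a: "a \<in> carrier (integer_mod_group n)"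
    using assms by (simp add: a_def carrier_integer_mod_group)
  have "ord a = n"
    using a by (subst ord_unique)
      (auto simp: a_def mod_mult_right_eq mod_eq_0_iff_dvd)
  moreover have "carrier (integer_mod_group n) = generate (integer_mod_group n) {a}"
  proof (rule sym, rule card_subset_eq)
    show "generate (integer_mod_group n) {a} \<subseteq> carrier (integer_mod_group n)"
      using a by (intro generate_incl) auto
    show "card (generate (integer_mod_group n) {a}) = card (carrier (integer_mod_group n))"
      using \<open>ord a = n\<close> generate_pow_card[OF a] assms by (simp add: carrier_integer_mod_group)
  qed (use assms in \<open>simp add: carrier_integer_mod_group\<close>)
  ultimately show ?thesis
    using card_ord_eq_in_generate[OF a] assms by simp
qed

text \<open>Integer powers in a subgroup agree with those in \<open>G\<close>, so being cyclic as a
  group of its own means being generated in \<open>G\<close> by one of its elements, and the order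
  of that element is the cardinality.\<close>

lemma (in group) cyclic_subgroups_of_order_eq:
  "cyclic_subgroups_of_order G d = (\<lambda>a. generate G {a}) ` {a \<in> carrier G. ord a = d}"
proof -
  have "cyclic_group (G\<lparr>carrier := H\<rparr>) \<longleftrightarrow> (\<exists>a\<in>H. H = generate G {a})" if "subgroup H G" for H
  proof -
    interpret H: group "G\<lparr>carrier := H\<rparr>"
      using that by (rule subgroup.subgroup_is_group) (rule is_group)
    have "range (\<lambda>k::int. a [^]\<^bsub>G\<lparr>carrier := H\<rparr>\<^esub> k) = generate G {a}" if "a \<in> H" for a
      using that int_pow_consistent[OF \<open>subgroup H G\<close> that]
        generate_pow[of a] subgroup.mem_carrier[OF \<open>subgroup H G\<close>] by auto
    then show ?thesis
      unfolding H.cyclic_group by auto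
  qed
  then have "cyclic_subgroups_of_order G d =
      {H. subgroup H G \<and> (\<exists>a\<in>H. H = generate G {a}) \<and> card H = d}"
    unfolding cyclic_subgroups_of_order_def order_def by auto
  also have "\<dots> = (\<lambda>a. generate G {a}) ` {a \<in> carrier G. ord a = d}"
  proof (intro Set.set_eqI iffI)
    fix H assume "H \<in> {H. subgroup H G \<and> (\<exists>a\<in>H. H = generate G {a}) \<and> card H = d}"
    then obtain a where "subgroup H G" "a \<in> H" and H: "H = generate G {a}" "card H = d"
      by blast
    then have "a \<in> carrier G" by (blast dest: subgroup.mem_carrier)
    with H show "H \<in> (\<lambda>a. generate G {a}) ` {a \<in> carrier G. ord a = d}"
      using generate_pow_card by blast
  next
    fix H assume "H \<in> (\<lambda>a. generate G {a}) ` {a \<in> carrier G. ord a = d}"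
    then obtain a where a: "a \<in> carrier G" "ord a = d" "H = generate G {a}"
      by blast
    then have "subgroup H G" "a \<in> H" "card H = d"
      by (simp_all add: generate_is_subgroup generate.incl generate_pow_card)
    with a show "H \<in> {H. subgroup H G \<and> (\<exists>a\<in>H. H = generate G {a}) \<and> card H = d}"
      by blast
  qed
  finally show ?thesis .
qed

text \<open>The elements of order \<open>d\<close> are partitioned by the subgroup they generate,
  and each class consists of the \<open>totient d\<close> generators of one subgroup.\<close>

lemma (in group) card_ord_eq_cyclic_subgroups:
  assumes fin: "finite (carrier G)" and "d > 0"
  shows "card {x \<in> carrier G. ord x = d} = card (cyclic_subgroups_of_order G d) * totient d"
proof -
  let ?C = "cyclic_subgroups_of_order G d"
  let ?E = "\<lambda>H. {x \<in> H. ord x = d}"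
  \<comment> \<open>An element of order \<open>d\<close> in a subgroup with \<open>d\<close>
    elements generates all of it, by finiteness. So \<open>x\<close> determines \<open>H\<close>,
    which later makes the sets \<open>?E H\<close> disjoint.\<close>
  have mem: "H = generate G {x} \<and> x \<in> carrier G" if "H \<in> ?C" "x \<in> ?E H" for H x
  proof -
    from that obtain a where a: "a \<in> carrier G" "ord a = d" "H = generate G {a}"
      by (auto simp: cyclic_subgroups_of_order_eq)
    have H: "subgroup H G" using a by (simp add: generate_is_subgroup)
    have x: "x \<in> carrier G" using that subgroup.mem_carrier[OF H] by auto
    have "generate G {x} = H"
    proof (rule card_subset_eq)
      show "finite H" using fin subgroup.subset[OF H] by (rule finite_subset[rotated])
      show "generate G {x} \<subseteq> H" using that H by (intro generate_subgroup_incl) auto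
      show "card (generate G {x}) = card H"
        using that a x by (simp add: generate_pow_card[symmetric])
    qed
    with x show ?thesis by simp
  qed
  have finC: "finite ?C" using fin by (simp add: cyclic_subgroups_of_order_eq)
  have "{x \<in> carrier G. ord x = d} = (\<Union>H\<in>?C. ?E H)"
  proof (intro subset_antisym subsetI)
    fix x assume "x \<in> {x \<in> carrier G. ord x = d}"
    then have "generate G {x} \<in> ?C" "x \<in> ?E (generate G {x})"
      by (auto simp: cyclic_subgroups_of_order_eq intro: generate.incl)
    then show "x \<in> (\<Union>H\<in>?C. ?E H)" by blast
  next
    fix x assume "x \<in> (\<Union>H\<in>?C. ?E H)"
    then show "x \<in> {x \<in> carrier G. ord x = d}" using mem by blast
  qed
  also have "card \<dots> = (\<Sum>H\<in>?C. card (?E H))"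
  proof (rule card_UN_disjoint[OF finC])
    show "\<forall>H\<in>?C. finite (?E H)"
    proof
      fix H assume "H \<in> ?C"
      then have "?E H \<subseteq> carrier G" using mem by blast
      then show "finite (?E H)" using fin by (rule finite_subset)
    qed
    show "\<forall>H\<in>?C. \<forall>K\<in>?C. H \<noteq> K \<longrightarrow> ?E H \<inter> ?E K = {}"
    proof (intro ballI impI)
      fix H K assume "H \<in> ?C" "K \<in> ?C" "H \<noteq> K"
      then show "?E H \<inter> ?E K = {}"
        using mem[of H] mem[of K] by blast
    qed
  qed
  also have "\<dots> = (\<Sum>H\<in>?C. totient d)"
  proof (intro sum.cong refl)
    fix H assume "H \<in> ?C"
    then obtain a where "a \<in> carrier G" "ord a = d" "H = generate G {a}"
      by (auto simp: cyclic_subgroups_of_order_eq)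
    then show "card (?E H) = totient d"
      using card_ord_eq_in_generate[of a d] \<open>d > 0\<close> by simp
  qed
  finally show ?thesis by simp
qed

text \<open>Sorting the pairs by the orders \<open>i\<close> and \<open>j\<close> of their
  components splits the set into disjoint rectangles, each with \<open>totient i * totient j\<close>
  elements.\<close>

lemma card_ord_eq_integer_mod_group_prod:
  fixes m n d :: nat
  assumes "m > 0" "n > 0"
  defines "G \<equiv> integer_mod_group m \<times>\<times> integer_mod_group n"
  shows "card {z \<in> carrier G. group.ord G z = d} =
    (\<Sum>(i, j) \<in> {(i, j). i dvd m \<and> j dvd n \<and> lcm i j = d}. totient i * totient j)"
proof -
  let ?E = "\<lambda>k i. {x \<in> carrier (integer_mod_group k). group.ord (integer_mod_group k) x = i}"
  let ?P = "{(i, j). i dvd m \<and> j dvd n \<and> lcm i j = d}"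
  have finE: "finite (?E k i)" if "k > 0" for k i
    by (rule finite_subset[of _ "carrier (integer_mod_group k)"])
       (use that in \<open>auto simp: carrier_integer_mod_group\<close>)
  \<comment> \<open>By Lagrange the component orders divide \<open>m\<close> and \<open>n\<close>,
    so the rectangles indexed by \<open>?P\<close> miss no pair.\<close>
  have dvd: "group.ord (integer_mod_group k) x dvd k"
    if "k > 0" "x \<in> carrier (integer_mod_group k)" for k x
    using group.ord_dvd_group_order[OF group_integer_mod_group that(2)] that
    by (simp add: order_def carrier_integer_mod_group)
  have finP: "finite ?P"
    using assms by (intro finite_subset[of ?P "{i. i dvd m} \<times> {j. j dvd n}"]) auto
  have eq: "{z \<in> carrier G. group.ord G z = d} = (\<Union>(i, j)\<in>?P. ?E m i \<times> ?E n j)"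
    using assms(1,2) dvd by (auto simp: G_def ord_DirProd)
  have "card {z \<in> carrier G. group.ord G z = d} =
      (\<Sum>p\<in>?P. card (case p of (i, j) \<Rightarrow> ?E m i \<times> ?E n j))"
    unfolding eq
  proof (rule card_UN_disjoint[OF finP])
    show "\<forall>p\<in>?P. finite (case p of (i, j) \<Rightarrow> ?E m i \<times> ?E n j)"
      using finE[OF assms(1)] finE[OF assms(2)] by (simp add: case_prod_unfold)
    show "\<forall>p\<in>?P. \<forall>q\<in>?P. p \<noteq> q \<longrightarrow>
        (case p of (i, j) \<Rightarrow> ?E m i \<times> ?E n j) \<inter> (case q of (i, j) \<Rightarrow> ?E m i \<times> ?E n j) = {}"
      by (auto simp: case_prod_unfold prod_eq_iff)
  qed
  also have "\<dots> = (\<Sum>(i, j)\<in>?P. totient i * totient j)"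
  proof (rule sum.cong[OF refl])
    fix p assume "p \<in> ?P"
    then obtain i j where p: "p = (i, j)" "i dvd m" "j dvd n" by (cases p) simp
    show "card (case p of (i, j) \<Rightarrow> ?E m i \<times> ?E n j) = (case p of (i, j) \<Rightarrow> totient i * totient j)"
      unfolding p(1) prod.case card_cartesian_product
      by (simp only: card_ord_eq_integer_mod_group assms(1,2) p)
  qed
  finally show ?thesis .
qed

theorem theorem4p7:
  fixes m n \<delta> :: nat
  assumes "m \<ge> 1" and "n \<ge> 1" and "\<delta> \<ge> 1"
    and "\<delta> dvd m * n"
  shows "num_cyclic_subgroups \<delta> m n =
    (\<Sum>(i, j) \<in> {(i, j). i \<ge> 1 \<and> j \<ge> 1 \<and> i dvd m \<and> j dvd n \<and> lcm i j = \<delta>}. totient (gcd i j))"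
proof -
  let ?G = "integer_mod_group m \<times>\<times> integer_mod_group n"
  let ?P = "{(i, j). i dvd m \<and> j dvd n \<and> lcm i j = \<delta>}"
  interpret G: group ?G by (simp add: DirProd_group)
  have P: "{(i, j). i \<ge> 1 \<and> j \<ge> 1 \<and> i dvd m \<and> j dvd n \<and> lcm i j = \<delta>} = ?P"
    using assms by (auto simp: Suc_le_eq intro: dvd_pos_nat)
  have "finite (carrier ?G)"
    using assms by (simp add: carrier_integer_mod_group)
  then have "num_cyclic_subgroups \<delta> m n * totient \<delta> = card {z \<in> carrier ?G. G.ord z = \<delta>}"
    using G.card_ord_eq_cyclic_subgroups assms by (simp add: num_cyclic_subgroups_def)
  also have "\<dots> = (\<Sum>(i, j)\<in>?P. totient i * totient j)"
    using assms by (intro card_ord_eq_integer_mod_group_prod) auto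
  also have "\<dots> = (\<Sum>(i, j)\<in>?P. totient (gcd i j) * totient \<delta>)"
    by (intro sum.cong) (auto simp: totient_gcd_lcm)
  also have "\<dots> = (\<Sum>(i, j)\<in>?P. totient (gcd i j)) * totient \<delta>"
    by (simp add: sum_distrib_right case_prod_unfold)
  \<comment> \<open>The common factor \<open>totient \<delta>\<close> cancels because it is positive
    for \<open>\<delta> \<ge> 1\<close>.\<close>
  finally show ?thesis
    using assms unfolding P by simp
qed

end
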